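(* For any $d\ge 1$, there is an algorithm which, given an $n$-point metric space $(X,\rho)$, runs in time $O(n^{d+3})$ and outputs a set $\mathcal{O}\subseteq X$ such that $(X\setminus\mathcal{O},\rho)$ admits an isometric embedding into $(\mathbb{R}^d,\|\cdot\|_2)$ and $|\mathcal{O}|\le 2\,|\mathcal{O}^*|$, where $\mathcal{O}^*$ is a minimum-cardinality subset of $X$ for which $(X\setminus\mathcal{O}^*,\rho)$ admits an isometric embedding into $\mathbb{R}^d$. That is, there is a $2$-approximation algorithm for minimum outlier embedding into $\mathbb{R}^d$ with running time $O(n^{d+3})$ (the $O$ hiding factors polynomial in $d$).
   Context: An isometric embedding of $(X,\rho)$ into $\mathbb{R}^d$ is a map $\phi:X\to\mathbb{R}^d$ with $\rho(x,y)=\|\phi(x)-\phi(y)\|_2$ for all $x,y\in X$. The minimum outlier embedding problem into $\mathbb{R}^d$ asks for a minimum-size $\mathcal{O}\subseteq X$ such that $(X\setminus\mathcal{O},\rho)$ embeds isometrically into $\mathbb{R}^d$. *)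

theory Defs
  imports
    "HOL-Analysis.Analysis"
    "HOL-Computational_Algebra.Polynomial"
begin

section \<open>Isometric embeddings and outlier sets\<close>

text \<open>
  The dimension is a value, so a point of \<open>\<real>\<^sup>d\<close> is given by its coordinates
  at the indices \<open>i < d\<close>; values at indices \<open>\<ge> d\<close> are irrelevant.
\<close>

definition euclidean_dist :: "nat \<Rightarrow> (nat \<Rightarrow> real) \<Rightarrow> (nat \<Rightarrow> real) \<Rightarrow> real" where
  "euclidean_dist d u v = L2_set (\<lambda>i. u i - v i) {..<d}"

definition isometric_embedding ::
  "nat \<Rightarrow> 'a set \<Rightarrow> ('a \<Rightarrow> 'a \<Rightarrow> real) \<Rightarrow> ('a \<Rightarrow> nat \<Rightarrow> real) \<Rightarrow> bool" where
  "isometric_embedding d X \<rho> \<phi> \<longleftrightarrow>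
     (\<forall>x\<in>X. \<forall>y\<in>X. \<rho> x y = euclidean_dist d (\<phi> x) (\<phi> y))"

definition embeddable :: "nat \<Rightarrow> 'a set \<Rightarrow> ('a \<Rightarrow> 'a \<Rightarrow> real) \<Rightarrow> bool" where
  "embeddable d X \<rho> \<longleftrightarrow> (\<exists>\<phi>. isometric_embedding d X \<rho> \<phi>)"

definition outlier_set :: "nat \<Rightarrow> 'a set \<Rightarrow> ('a \<Rightarrow> 'a \<Rightarrow> real) \<Rightarrow> 'a set \<Rightarrow> bool" where
  "outlier_set d X \<rho> S \<longleftrightarrow> S \<subseteq> X \<and> embeddable d (X - S) \<rho>"

text \<open>Only used for finite \<open>X\<close>, where \<open>card\<close> is the actual cardinality.\<close>

definition minimum_outlier_set ::
  "nat \<Rightarrow> 'a set \<Rightarrow> ('a \<Rightarrow> 'a \<Rightarrow> real) \<Rightarrow> 'a set \<Rightarrow> bool" where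
  "minimum_outlier_set d X \<rho> S \<longleftrightarrow> is_arg_min card (outlier_set d X \<rho>) S"

section \<open>Real RAM programs\<close>

text \<open>
  The model of computation is the unit-cost real RAM, presented as a structured
  language. There are two kinds of values: natural numbers, which serve as counters
  and addresses, and exact real numbers. Each kind has scalar variables and
  one-dimensional arrays with indirect addressing; the names of variables and arrays
  are constants of the program text, so a program uses only finitely many of them.

  Available at unit cost are addition and subtraction of naturals, the four field
  operations on reals, and comparisons within each kind. There is no conversion
  between the two kinds, no rounding and no root extraction, and the literals are
  integers, so a program cannot smuggle in information through a real constant.

  The input metric is a read-only distance matrix; \<open>RDist i j\<close> denotes its
  entry at \<open>(i, j)\<close>.
\<close>

datatype iexp =
    IConst nat
  | IVar nat
  | IArr nat iexp
  | IAdd iexp iexp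
  | ISub iexp iexp

datatype rexp =
    RConst int
  | RVar nat
  | RArr nat iexp
  | RDist iexp iexp
  | RAdd rexp rexp
  | RSub rexp rexp
  | RMul rexp rexp
  | RDiv rexp rexp

datatype bexp =
    ILess iexp iexp
  | RLess rexp rexp
  | BNot bexp
  | BAnd bexp bexp

datatype com =
    Skip
  | IAssign nat iexp
  | RAssign nat rexp
  | IStore nat iexp iexp
  | RStore nat iexp rexp
  | Seq com com
  | Branch bexp com com
  | While bexp com

record state =
  ivar :: "nat \<Rightarrow> nat"
  rvar :: "nat \<Rightarrow> real"
  iarr :: "nat \<Rightarrow> nat \<Rightarrow> nat"
  rarr :: "nat \<Rightarrow> nat \<Rightarrow> real"

text \<open>
  Subtraction of naturals is truncated at 0 and division by 0 yields 0. As both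
  situations can be detected by a comparison, this does not add computational power.
\<close>

fun ival :: "state \<Rightarrow> iexp \<Rightarrow> nat" where
  "ival s (IConst k) = k"
| "ival s (IVar x) = ivar s x"
| "ival s (IArr a i) = iarr s a (ival s i)"
| "ival s (IAdd e f) = ival s e + ival s f"
| "ival s (ISub e f) = ival s e - ival s f"

fun rval :: "(nat \<Rightarrow> nat \<Rightarrow> real) \<Rightarrow> state \<Rightarrow> rexp \<Rightarrow> real" where
  "rval D s (RConst k) = of_int k"
| "rval D s (RVar x) = rvar s x"
| "rval D s (RArr a i) = rarr s a (ival s i)"
| "rval D s (RDist i j) = D (ival s i) (ival s j)"
| "rval D s (RAdd e f) = rval D s e + rval D s f"
| "rval D s (RSub e f) = rval D s e - rval D s f"
| "rval D s (RMul e f) = rval D s e * rval D s f"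
| "rval D s (RDiv e f) = rval D s e / rval D s f"

fun bval :: "(nat \<Rightarrow> nat \<Rightarrow> real) \<Rightarrow> state \<Rightarrow> bexp \<Rightarrow> bool" where
  "bval D s (ILess e f) \<longleftrightarrow> ival s e < ival s f"
| "bval D s (RLess e f) \<longleftrightarrow> rval D s e < rval D s f"
| "bval D s (BNot b) \<longleftrightarrow> \<not> bval D s b"
| "bval D s (BAnd b c) \<longleftrightarrow> bval D s b \<and> bval D s c"

text \<open>Evaluating an expression costs one unit for each of its nodes.\<close>

fun icost :: "iexp \<Rightarrow> nat" where
  "icost (IConst k) = 1"
| "icost (IVar x) = 1"
| "icost (IArr a i) = 1 + icost i"
| "icost (IAdd e f) = 1 + icost e + icost f"
| "icost (ISub e f) = 1 + icost e + icost f"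

fun rcost :: "rexp \<Rightarrow> nat" where
  "rcost (RConst k) = 1"
| "rcost (RVar x) = 1"
| "rcost (RArr a i) = 1 + icost i"
| "rcost (RDist i j) = 1 + icost i + icost j"
| "rcost (RAdd e f) = 1 + rcost e + rcost f"
| "rcost (RSub e f) = 1 + rcost e + rcost f"
| "rcost (RMul e f) = 1 + rcost e + rcost f"
| "rcost (RDiv e f) = 1 + rcost e + rcost f"

fun bcost :: "bexp \<Rightarrow> nat" where
  "bcost (ILess e f) = 1 + icost e + icost f"
| "bcost (RLess e f) = 1 + rcost e + rcost f"
| "bcost (BNot b) = 1 + bcost b"
| "bcost (BAnd b c) = 1 + bcost b + bcost c"

text \<open>
  \<open>exec D c s t s'\<close>: on the distance matrix \<open>D\<close>, the program \<open>c\<close> started in state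
  \<open>s\<close> terminates in state \<open>s'\<close> after \<open>t\<close> units of time.
\<close>

inductive exec ::
  "(nat \<Rightarrow> nat \<Rightarrow> real) \<Rightarrow> com \<Rightarrow> state \<Rightarrow> nat \<Rightarrow> state \<Rightarrow> bool"
  for D :: "nat \<Rightarrow> nat \<Rightarrow> real"
where
  Skip: "exec D Skip s 1 s"
| IAssign: "exec D (IAssign x e) s (1 + icost e)
    (s\<lparr>ivar := (ivar s)(x := ival s e)\<rparr>)"
| RAssign: "exec D (RAssign x e) s (1 + rcost e)
    (s\<lparr>rvar := (rvar s)(x := rval D s e)\<rparr>)"
| IStore: "exec D (IStore a i e) s (1 + icost i + icost e)
    (s\<lparr>iarr := (iarr s)(a := (iarr s a)(ival s i := ival s e))\<rparr>)"
| RStore: "exec D (RStore a i e) s (1 + icost i + rcost e)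
    (s\<lparr>rarr := (rarr s)(a := (rarr s a)(ival s i := rval D s e))\<rparr>)"
| Seq: "\<lbrakk>exec D c1 s1 t1 s2; exec D c2 s2 t2 s3\<rbrakk>
    \<Longrightarrow> exec D (Seq c1 c2) s1 (t1 + t2) s3"
| BranchTrue: "\<lbrakk>bval D s b; exec D c1 s t s'\<rbrakk>
    \<Longrightarrow> exec D (Branch b c1 c2) s (1 + bcost b + t) s'"
| BranchFalse: "\<lbrakk>\<not> bval D s b; exec D c2 s t s'\<rbrakk>
    \<Longrightarrow> exec D (Branch b c1 c2) s (1 + bcost b + t) s'"
| WhileFalse: "\<not> bval D s b \<Longrightarrow> exec D (While b c) s (1 + bcost b) s"
| WhileTrue: "\<lbrakk>bval D s1 b; exec D c s1 t1 s2; exec D (While b c) s2 t2 s3\<rbrakk>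
    \<Longrightarrow> exec D (While b c) s1 (1 + bcost b + t1 + t2) s3"

inductive_cases SkipE: "exec D Skip s t s'"
inductive_cases IAssignE: "exec D (IAssign x e) s t s'"
inductive_cases RAssignE: "exec D (RAssign x e) s t s'"
inductive_cases IStoreE: "exec D (IStore a i e) s t s'"
inductive_cases RStoreE: "exec D (RStore a i e) s t s'"
inductive_cases SeqE: "exec D (Seq c1 c2) s t s'"
inductive_cases BranchE: "exec D (Branch b c1 c2) s t s'"
inductive_cases WhileE: "exec D (While b c) s t s'"

lemma exec_deterministic:
  "exec D c s t s' \<Longrightarrow> exec D c s u s'' \<Longrightarrow> t = u \<and> s' = s''"
proof (induction arbitrary: u s'' rule: exec.induct)
  case (Seq c1 s1 t1 s2 c2 t2 s3)
  from Seq.prems show ?case by (rule SeqE) (auto dest: Seq.IH)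
next
  case (BranchTrue s b c1 t s' c2)
  from BranchTrue.prems show ?case
    by (rule BranchE) (auto simp: BranchTrue.hyps(1) dest: BranchTrue.IH)
next
  case (BranchFalse s b c2 t s' c1)
  from BranchFalse.prems show ?case
    by (rule BranchE) (auto simp: BranchFalse.hyps(1) dest: BranchFalse.IH)
next
  case (WhileFalse s b c)
  from WhileFalse.prems show ?case
    by (rule WhileE) (simp_all add: WhileFalse.hyps)
next
  case (WhileTrue s1 b c t1 s2 t2 s3)
  from WhileTrue.prems show ?case
    by (rule WhileE) (auto simp: WhileTrue.hyps(1) dest: WhileTrue.IH)
qed (erule SkipE IAssignE RAssignE IStoreE RStoreE; simp)+

text \<open>
  An \<open>n\<close>-point metric space is presented with its points numbered \<open>0, \<dots>, n - 1\<close>.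
  Initially integer variable 0 holds \<open>n\<close>, and all other cells are 0. The output is the
  set of points at which integer array 0 is nonzero.
\<close>

definition distance_matrix :: "nat \<Rightarrow> (nat \<Rightarrow> nat \<Rightarrow> real) \<Rightarrow> nat \<Rightarrow> nat \<Rightarrow> real" where
  "distance_matrix n \<rho> = (\<lambda>i j. if i < n \<and> j < n then \<rho> i j else 0)"

definition initial_state :: "nat \<Rightarrow> state" where
  "initial_state n =
     \<lparr>ivar = (\<lambda>_. 0)(0 := n), rvar = \<lambda>_. 0, iarr = \<lambda>_ _. 0, rarr = \<lambda>_ _. 0\<rparr>"

definition output_set :: "nat \<Rightarrow> state \<Rightarrow> nat set" where
  "output_set n s = {i. i < n \<and> iarr s 0 i \<noteq> 0}"

definition computes ::
  "com \<Rightarrow> nat \<Rightarrow> (nat \<Rightarrow> nat \<Rightarrow> real) \<Rightarrow> nat \<Rightarrow> nat set \<Rightarrow> bool" where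
  "computes c n \<rho> t S \<longleftrightarrow>
     (\<exists>s. exec (distance_matrix n \<rho>) c (initial_state n) t s \<and> S = output_set n s)"

end

theory Submission
  imports Defs
begin

text \<open>
  Fix a base point and \<open>d\<close> pivot points and eliminate the pivots from the Gram matrix of the space
  by successive Schur complements. For every choice of these points, a set on which the remaining
  matrix \<open>h\<close> vanishes embeds into \<open>\<real>\<^sup>d\<close>, the pivot rows giving the coordinates. Conversely, if the
  points outside an outlier set embed, then for a suitable choice among them \<open>h\<close> vanishes on them,
  since each elimination projects the embedding along one vector. For a fixed choice it remains to
  cover the pairs \<open>(x, y)\<close> with \<open>h x y \<noteq> 0\<close> (including \<open>x = y\<close>) by points. A greedy matching does so
  within a factor of 2, in time \<open>O(n\<^sup>2)\<close> for each of the \<open>n\<^bsup>d+1\<^esup>\<close> choices.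
\<close>

section \<open>Executing counting loops\<close>

text \<open>Every while loop is charged for \<open>n\<close> iterations, so this bounds the running time only
  of programs whose loops are all of the form \<open>for_loop\<close>.\<close>

fun time_bound :: "nat \<Rightarrow> com \<Rightarrow> nat" where
  "time_bound n Skip = 1"
| "time_bound n (IAssign x e) = 1 + icost e"
| "time_bound n (RAssign x e) = 1 + rcost e"
| "time_bound n (IStore a i e) = 1 + icost i + icost e"
| "time_bound n (RStore a i e) = 1 + icost i + rcost e"
| "time_bound n (Seq c1 c2) = time_bound n c1 + time_bound n c2"
| "time_bound n (Branch b c1 c2) = 1 + bcost b + time_bound n c1 + time_bound n c2"
| "time_bound n (While b c) = n * (1 + bcost b + time_bound n c) + (1 + bcost b)"

text \<open>Total correctness with the time bound built in. Since \<open>time_bound\<close> is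
  computed from the program text alone, running time never enters an invariant and is estimated
  separately.\<close>

definition runs ::
  "(nat \<Rightarrow> nat \<Rightarrow> real) \<Rightarrow> nat \<Rightarrow> com \<Rightarrow> state \<Rightarrow> (state \<Rightarrow> bool) \<Rightarrow> bool" where
  "runs D n c s Q \<longleftrightarrow> (\<exists>t s'. exec D c s t s' \<and> t \<le> time_bound n c \<and> Q s')"

lemma runs_Skip: "Q s \<Longrightarrow> runs D n Skip s Q"
  unfolding runs_def by (metis exec.Skip order_refl time_bound.simps(1))

lemma runs_IAssign:
  "Q (s\<lparr>ivar := (ivar s)(x := ival s e)\<rparr>) \<Longrightarrow> runs D n (IAssign x e) s Q"
  unfolding runs_def by (metis exec.IAssign order_refl time_bound.simps(2))

lemma runs_RAssign:
  "Q (s\<lparr>rvar := (rvar s)(x := rval D s e)\<rparr>) \<Longrightarrow> runs D n (RAssign x e) s Q"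
  unfolding runs_def by (metis exec.RAssign order_refl time_bound.simps(3))

lemma runs_IStore:
  "Q (s\<lparr>iarr := (iarr s)(a := (iarr s a)(ival s i := ival s e))\<rparr>) \<Longrightarrow> runs D n (IStore a i e) s Q"
  unfolding runs_def by (metis exec.IStore order_refl time_bound.simps(4))

lemma runs_RStore:
  "Q (s\<lparr>rarr := (rarr s)(a := (rarr s a)(ival s i := rval D s e))\<rparr>) \<Longrightarrow> runs D n (RStore a i e) s Q"
  unfolding runs_def by (metis exec.RStore order_refl time_bound.simps(5))

lemma runs_Seq: "runs D n c1 s (\<lambda>s'. runs D n c2 s' Q) \<Longrightarrow> runs D n (Seq c1 c2) s Q"
  unfolding runs_def by (fastforce intro: exec.Seq add_mono)

lemma runs_Branch:
  assumes "bval D s b \<Longrightarrow> runs D n c1 s Q" "\<not> bval D s b \<Longrightarrow> runs D n c2 s Q"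
  shows "runs D n (Branch b c1 c2) s Q"
proof (cases "bval D s b")
  case True
  with assms(1) obtain t s' where "exec D c1 s t s'" "t \<le> time_bound n c1" "Q s'"
    unfolding runs_def by blast
  with BranchTrue[OF True] show ?thesis unfolding runs_def by fastforce
next
  case False
  with assms(2) obtain t s' where "exec D c2 s t s'" "t \<le> time_bound n c2" "Q s'"
    unfolding runs_def by blast
  with BranchFalse[OF False] show ?thesis unfolding runs_def by fastforce
qed

lemma runs_mono: "runs D n c s Q \<Longrightarrow> (\<And>s'. Q s' \<Longrightarrow> R s') \<Longrightarrow> runs D n c s R"
  unfolding runs_def by blast

definition for_loop :: "nat \<Rightarrow> com \<Rightarrow> com" where
  "for_loop v c = Seq (IAssign v (IConst 0))
     (While (ILess (IVar v) (IVar 0)) (Seq c (IAssign v (IAdd (IVar v) (IConst 1)))))"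

lemma time_bound_for_loop [simp]: "time_bound n (for_loop v c) = n * (time_bound n c + 8) + 6"
  by (simp add: for_loop_def algebra_simps)

text \<open>The invariant is required again only after the increment. The body keeps the counter and
  the bound in variable 0, which forces exactly \<open>n\<close> iterations, the number that
  \<open>time_bound\<close> charges.\<close>

lemma runs_for_loop:
  assumes n: "ivar s 0 = n" and v: "v \<noteq> 0"
    and start: "I 0 (s\<lparr>ivar := (ivar s)(v := 0)\<rparr>)"
    and step: "\<And>i s. i < n \<Longrightarrow> ivar s 0 = n \<Longrightarrow> ivar s v = i \<Longrightarrow> I i s \<Longrightarrow>
      runs D n c s (\<lambda>s'. ivar s' 0 = n \<and> ivar s' v = i \<and> I (Suc i) (s'\<lparr>ivar := (ivar s')(v := Suc i)\<rparr>))"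
    and final: "\<And>s. ivar s 0 = n \<Longrightarrow> I n s \<Longrightarrow> Q s"
  shows "runs D n (for_loop v c) s Q"
proof -
  let ?b = "ILess (IVar v) (IVar 0)"
  let ?c = "Seq c (IAssign v (IAdd (IVar v) (IConst 1)))"
  \<comment> \<open>Induction on the number \<open>j\<close> of iterations still to run.\<close>
  have loop: "\<exists>t s'. exec D (While ?b ?c) s t s' \<and>
      t \<le> j * (1 + bcost ?b + time_bound n ?c) + (1 + bcost ?b) \<and> ivar s' 0 = n \<and> I n s'"
    if "j \<le> n" "ivar s 0 = n" "ivar s v = n - j" "I (n - j) s" for j s
    using that
  proof (induction j arbitrary: s)
    case 0
    then have "exec D (While ?b ?c) s (1 + bcost ?b) s" by (intro exec.WhileFalse) simp
    with 0 show ?case by fastforce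
  next
    case (Suc j)
    let ?i = "n - Suc j"
    have i: "?i < n" "Suc ?i = n - j" using Suc.prems by auto
    from step[OF i(1) Suc.prems(2-4)] obtain t1 s1 where 1:
      "exec D c s t1 s1" "t1 \<le> time_bound n c" "ivar s1 0 = n" "ivar s1 v = ?i"
      "I (Suc ?i) (s1\<lparr>ivar := (ivar s1)(v := Suc ?i)\<rparr>)"
      unfolding runs_def by blast
    let ?s = "s1\<lparr>ivar := (ivar s1)(v := Suc ?i)\<rparr>"
    let ?e = "IAdd (IVar v) (IConst 1)"
    have "exec D (IAssign v ?e) s1 (1 + icost ?e) ?s"
      using exec.IAssign[of D v ?e s1] 1(4) by (metis Suc_eq_plus1 ival.simps(1,2,4))
    with 1(1) have e1: "exec D ?c s (t1 + (1 + icost ?e)) ?s" by (rule exec.Seq)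
    have "\<exists>t s'. exec D (While ?b ?c) ?s t s' \<and>
      t \<le> j * (1 + bcost ?b + time_bound n ?c) + (1 + bcost ?b) \<and> ivar s' 0 = n \<and> I n s'"
      using Suc.prems 1 v by (intro Suc.IH) (auto simp: i(2))
    then obtain t2 s2 where 2: "exec D (While ?b ?c) ?s t2 s2"
      "t2 \<le> j * (1 + bcost ?b + time_bound n ?c) + (1 + bcost ?b)" "ivar s2 0 = n" "I n s2"
      by blast
    have "bval D s ?b" using Suc.prems by simp
    from exec.WhileTrue[OF this e1 2(1)] 1(2) 2 show ?case
      by (intro exI[of _ "1 + bcost ?b + (t1 + (1 + icost ?e)) + t2"] exI[of _ s2]) auto
  qed
  have "runs D n (While ?b ?c) (s\<lparr>ivar := (ivar s)(v := 0)\<rparr>) Q"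
    using loop[of n "s\<lparr>ivar := (ivar s)(v := 0)\<rparr>"] n v start final
    unfolding runs_def by fastforce
  then show ?thesis
    unfolding for_loop_def by (intro runs_Seq runs_IAssign) simp
qed

section \<open>Gram matrices and Schur complements\<close>

text \<open>Twice the Gram matrix of the vectors from \<open>z\<close> to the points; the factor 2 avoids divisions.\<close>

definition gram :: "(nat \<Rightarrow> nat \<Rightarrow> real) \<Rightarrow> nat \<Rightarrow> nat \<Rightarrow> nat \<Rightarrow> real" where
  "gram D z x y = D z x * D z x + D z y * D z y - D x y * D x y"

text \<open>Elimination with a nonpositive pivot does nothing. This makes every sequence of pivots
  admissible, including those for point sets spanning less than the whole space.\<close>

definition pivot_inverse :: "real \<Rightarrow> real" where
  "pivot_inverse r = (if 0 < r then 1 / r else 0)"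

text \<open>With \<open>g y b\<close> in place of \<open>g b y\<close>, the subtracted matrix is
  symmetric of rank at most one for every \<open>g\<close>, and only one column per pivot has to be
  stored.\<close>

definition schur :: "(nat \<Rightarrow> nat \<Rightarrow> real) \<Rightarrow> nat \<Rightarrow> nat \<Rightarrow> nat \<Rightarrow> real" where
  "schur g b x y = g x y - pivot_inverse (g b b) * g x b * g y b"

text \<open>Pivots may repeat: once a pivot has been used, its diagonal entry is not positive, so
  eliminating with it again changes nothing.\<close>

primrec eliminations :: "nat \<Rightarrow> nat \<Rightarrow> (nat \<Rightarrow> nat \<Rightarrow> real) \<Rightarrow> (nat \<Rightarrow> nat \<Rightarrow> real) set" where
  "eliminations n 0 g = {g}"
| "eliminations n (Suc m) g = (\<Union>b<n. eliminations n m (schur g b))"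

text \<open>A vertex cover of the graph whose edges are the nonzero entries; a nonzero diagonal
  entry is a loop and forces its point into \<open>K\<close>.\<close>

definition covers :: "nat \<Rightarrow> (nat \<Rightarrow> nat \<Rightarrow> real) \<Rightarrow> nat set \<Rightarrow> bool" where
  "covers n g K \<longleftrightarrow> K \<subseteq> {..<n} \<and> (\<forall>x<n. \<forall>y<n. x \<notin> K \<longrightarrow> y \<notin> K \<longrightarrow> g x y = 0)"

lemma pivot_inverse_nonneg: "0 \<le> pivot_inverse r"
  by (simp add: pivot_inverse_def)

section \<open>Covers of eliminated matrices versus embeddings\<close>

text \<open>Each elimination subtracts a rank-one matrix with a nonnegative coefficient. The pivot
  column times the square root of that coefficient is a new coordinate, placed at index
  \<open>m\<close> behind those of the later eliminations.\<close>

lemma eliminations_decompose: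
  "h \<in> eliminations n m g \<Longrightarrow> \<exists>\<phi>. \<forall>x y. g x y = h x y + (\<Sum>i<m. \<phi> x i * \<phi> y i)"
proof (induction m arbitrary: g)
  case 0
  then show ?case by simp
next
  case (Suc m)
  then obtain b where "h \<in> eliminations n m (schur g b)" by auto
  from Suc.IH[OF this] obtain \<phi> where
    \<phi>: "\<And>x y. schur g b x y = h x y + (\<Sum>i<m. \<phi> x i * \<phi> y i)" by blast
  define c where "c = sqrt (pivot_inverse (g b b))"
  have c: "c * c = pivot_inverse (g b b)"
    by (simp add: c_def pivot_inverse_nonneg)
  define \<psi> where "\<psi> x = (\<phi> x)(m := c * g x b)" for x
  have "g x y = h x y + (\<Sum>i<Suc m. \<psi> x i * \<psi> y i)" for x y
  proof -
    have "(\<Sum>i<m. \<psi> x i * \<psi> y i) = (\<Sum>i<m. \<phi> x i * \<phi> y i)"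
      by (intro sum.cong) (auto simp: \<psi>_def)
    moreover have "\<psi> x m * \<psi> y m = pivot_inverse (g b b) * g x b * g y b"
      by (simp add: \<psi>_def c[symmetric])
    ultimately show ?thesis using \<phi>[of x y] by (simp add: schur_def)
  qed
  then show ?case by blast
qed

text \<open>Outside \<open>K\<close> only the sum of products survives, so the entries there are
  inner products in dimension \<open>d\<close>, and polarization recovers the distances. The
  identity is algebraic: the base point and the pivots may themselves lie in
  \<open>K\<close>.\<close>

lemma embeddable_if_covers:
  assumes "Metric_space {..<n} \<rho>" "z < n" "covers n h K"
    and h: "h \<in> eliminations n d (gram (distance_matrix n \<rho>) z)"
  shows "embeddable d ({..<n} - K) \<rho>"
proof -
  let ?D = "distance_matrix n \<rho>"
  obtain \<phi> where \<phi>: "\<And>x y. gram ?D z x y = h x y + (\<Sum>i<d. \<phi> x i * \<phi> y i)"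
    using eliminations_decompose[OF h] by blast
  \<comment> \<open>Undoes the factor 2 in \<open>gram\<close>.\<close>
  define \<psi> where "\<psi> x i = \<phi> x i / sqrt 2" for x i
  have "\<rho> x y = euclidean_dist d (\<psi> x) (\<psi> y)"
    if x: "x < n" "x \<notin> K" and y: "y < n" "y \<notin> K" for x y
  proof -
    have D: "?D x x = 0" "?D y y = 0" "?D x y = \<rho> x y" "0 \<le> \<rho> x y"
      using assms(1) x y by (auto simp: distance_matrix_def Metric_space_def)
    have g: "gram ?D z a b = (\<Sum>i<d. \<phi> a i * \<phi> b i)" if "a \<in> {x, y}" "b \<in> {x, y}" for a b
      using \<phi>[of a b] that assms(3) x y unfolding covers_def by auto
    have "2 * (\<rho> x y)\<^sup>2 = gram ?D z x x + gram ?D z y y - 2 * gram ?D z x y"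
      using D by (simp add: gram_def power2_eq_square)
    also have "\<dots> = (\<Sum>i<d. (\<phi> x i - \<phi> y i)\<^sup>2)"
      by (simp add: g power2_diff power2_eq_square sum.distrib sum_subtractf sum_distrib_left
          algebra_simps)
    also have "\<dots> = 2 * (\<Sum>i<d. (\<psi> x i - \<psi> y i)\<^sup>2)"
      by (simp add: \<psi>_def sum_distrib_left power_divide flip: diff_divide_distrib)
    finally have "(\<rho> x y)\<^sup>2 = (\<Sum>i<d. (\<psi> x i - \<psi> y i)\<^sup>2)" by simp
    with D(4) show ?thesis
      unfolding euclidean_dist_def L2_set_def by (metis real_sqrt_unique)
  qed
  then show ?thesis
    unfolding embeddable_def isometric_embedding_def by (intro exI[of _ \<psi>]) auto
qed

text \<open>Reflecting \<open>w b\<close> onto a multiple of the last unit vector turns the orthogonal projection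
  along \<open>w b\<close> into the deletion of the last coordinate.\<close>

lemma householder:
  fixes w :: "'a \<Rightarrow> nat \<Rightarrow> real" and m :: nat
  defines "ip \<equiv> \<lambda>x y. \<Sum>i<Suc m. w x i * w y i"
  assumes pos: "0 < ip b b"
  shows "\<exists>u. \<forall>x y. ip x y - ip x b * ip y b / ip b b = (\<Sum>i<m. u x i * u y i)"
proof -
  \<comment> \<open>The sign is chosen to make \<open>r * w b m\<close> nonnegative, which keeps the
    denominator \<open>q\<close> positive.\<close>
  define r where "r = (if 0 \<le> w b m then 1 else - 1) * sqrt (ip b b)"
  have r: "r * r = ip b b" "0 \<le> r * w b m"
    using pos by (auto simp: r_def zero_le_mult_iff mult_le_0_iff)
  define q where "q = r * r + r * w b m"
  have q: "0 < q" using pos r by (simp add: q_def)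
  \<comment> \<open>Let \<open>v\<close> be \<open>w b\<close> plus \<open>r\<close> times the last
    unit vector. Then \<open>q\<close> is half the squared norm of \<open>v\<close>, and
    \<open>w x - a x * v\<close> is the reflection of \<open>w x\<close>; it sends
    \<open>w b\<close> to \<open>- r\<close> times that unit vector. Below index \<open>m\<close>,
    \<open>u x\<close> agrees with the reflected vector.\<close>
  define a where "a x = (ip x b + r * w x m) / q" for x
  define u where "u x i = w x i - a x * w b i" for x i
  have "ip x y - ip x b * ip y b / ip b b = (\<Sum>i<m. u x i * u y i)" for x y
  proof -
    define A P Q V where "A = (\<Sum>i<m. w x i * w y i)" and "P = (\<Sum>i<m. w x i * w b i)"
      and "Q = (\<Sum>i<m. w y i * w b i)" and "V = (\<Sum>i<m. w b i * w b i)"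
    have ip: "ip x y = A + w x m * w y m" "ip x b = P + w x m * w b m"
      "ip y b = Q + w y m * w b m" "ip b b = V + w b m * w b m"
      by (simp_all add: ip_def A_def P_def Q_def V_def)
    have V: "V = r * r - w b m * w b m" using r(1) ip(4) by simp
    have "(\<Sum>i<m. u x i * u y i) = A - a y * P - a x * Q + a x * a y * V"
      by (simp add: u_def A_def P_def Q_def V_def sum_distrib_left sum.distrib sum_subtractf
          algebra_simps)
    also have "\<dots> = A + w x m * w y m - (P + w x m * w b m) * (Q + w y m * w b m) / (r * r)"
    proof -
      define s where "s = r + w b m"
      have q': "q = r * s" by (simp add: q_def s_def distrib_left)
      have "r \<noteq> 0" using q by (auto simp: q_def)
      have "a x * q = P + w x m * w b m + r * w x m" "a y * q = Q + w y m * w b m + r * w y m"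
        using q by (simp_all add: a_def ip)
      then have P: "P = a x * r * s - w x m * s" and Q: "Q = a y * r * s - w y m * s"
        by (simp_all add: q' s_def algebra_simps)
      \<comment> \<open>\<open>a x * s - w x m\<close> is the negated last coordinate of the
        reflected vector, so the quotient below is the product of the two deleted
        coordinates.\<close>
      have "P + w x m * w b m = r * (a x * s - w x m)" "Q + w y m * w b m = r * (a y * s - w y m)"
        unfolding P Q s_def by (simp_all add: algebra_simps)
      then have "(P + w x m * w b m) * (Q + w y m * w b m) / (r * r)
          = (a x * s - w x m) * (a y * s - w y m)"
        using \<open>r \<noteq> 0\<close> by simp
      then show ?thesis
        unfolding V P Q s_def by (simp add: algebra_simps)
    qed
    finally show ?thesis using ip r(1) by simp
  qed
  then show ?thesis by blast
qed

text \<open>If some point of \<open>T\<close> has a positive diagonal entry, eliminating it projects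
  along its vector, and \<open>householder\<close> writes the result with one coordinate fewer.
  After \<open>m\<close> rounds no coordinate is left.\<close>

lemma eliminations_vanish:
  assumes "T \<subseteq> {..<n}" "T \<noteq> {}" "\<And>x y. x \<in> T \<Longrightarrow> y \<in> T \<Longrightarrow> g x y = (\<Sum>i<m. w x i * w y i)"
  shows "\<exists>h \<in> eliminations n m g. \<forall>x\<in>T. \<forall>y\<in>T. h x y = 0"
  using assms(3)
proof (induction m arbitrary: g w)
  case 0
  then show ?case by simp
next
  case (Suc m)
  have "\<exists>b\<in>T. \<exists>u. \<forall>x\<in>T. \<forall>y\<in>T. schur g b x y = (\<Sum>i<m. u x i * u y i)"
  proof (cases "\<exists>b\<in>T. 0 < g b b")
    case True
    then obtain b where b: "b \<in> T" "0 < g b b" by blast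
    obtain u where u: "\<And>x y. (\<Sum>i<Suc m. w x i * w y i) -
        (\<Sum>i<Suc m. w x i * w b i) * (\<Sum>i<Suc m. w y i * w b i) / (\<Sum>i<Suc m. w b i * w b i)
        = (\<Sum>i<m. u x i * u y i)"
      using householder[where w = w and m = m and b = b] b(2)
      unfolding Suc.prems[OF b(1) b(1)] by blast
    have "schur g b x y = (\<Sum>i<m. u x i * u y i)" if "x \<in> T" "y \<in> T" for x y
      using b(2) unfolding u[symmetric] Suc.prems[OF that, symmetric]
        Suc.prems[OF that(1) b(1), symmetric] Suc.prems[OF that(2) b(1), symmetric]
        Suc.prems[OF b(1) b(1), symmetric]
      using Suc.prems[OF that(2) b(1)] Suc.prems[OF b(1) that(2)]
      by (simp add: schur_def pivot_inverse_def mult.commute)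
    with b(1) show ?thesis by blast
  next
    case False
    obtain b where b: "b \<in> T" using assms(2) by blast
    have "w x i = 0" if "x \<in> T" "i < Suc m" for x i
    proof -
      have "(\<Sum>i<Suc m. w x i * w x i) \<le> 0"
        using False that(1) Suc.prems[OF that(1) that(1)] by (metis not_le)
      moreover have "(\<Sum>i<Suc m. w x i * w x i) \<ge> 0" by (intro sum_nonneg) simp
      ultimately have "(\<Sum>i<Suc m. w x i * w x i) = 0" by linarith
      then have "\<forall>i\<in>{..<Suc m}. w x i * w x i = 0" by (subst (asm) sum_nonneg_eq_0_iff) auto
      with that(2) show ?thesis by auto
    qed
    then have "schur g b x y = (\<Sum>i<m. w x i * w y i)" if "x \<in> T" "y \<in> T" for x y
      using False b Suc.prems[OF that] that by (simp add: schur_def pivot_inverse_def)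
    with b show ?thesis by blast
  qed
  then obtain b u where b: "b \<in> T"
    and u: "\<And>x y. x \<in> T \<Longrightarrow> y \<in> T \<Longrightarrow> schur g b x y = (\<Sum>i<m. u x i * u y i)" by blast
  from Suc.IH[where g = "schur g b", OF u] obtain h where
    "h \<in> eliminations n m (schur g b)" "\<forall>x\<in>T. \<forall>y\<in>T. h x y = 0" by blast
  with b assms(1) show ?case by auto
qed

text \<open>The base point is taken among the retained points, of which the second assumption
  provides one. The vectors from its image, scaled by \<open>sqrt 2\<close> to match the doubled
  Gram matrix, feed \<open>eliminations_vanish\<close>.\<close>

lemma covers_if_outlier_set:
  assumes "outlier_set d {..<n} \<rho> K" "K \<noteq> {..<n}"
  shows "\<exists>z<n. \<exists>h \<in> eliminations n d (gram (distance_matrix n \<rho>) z). covers n h K"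
proof -
  let ?T = "{..<n} - K" and ?D = "distance_matrix n \<rho>"
  have K: "K \<subseteq> {..<n}" and T: "?T \<noteq> {}" using assms by (auto simp: outlier_set_def)
  then obtain z where z: "z \<in> ?T" by blast
  obtain \<phi> where \<phi>: "\<And>x y. x \<in> ?T \<Longrightarrow> y \<in> ?T \<Longrightarrow> \<rho> x y = euclidean_dist d (\<phi> x) (\<phi> y)"
    using assms(1) by (auto simp: outlier_set_def embeddable_def isometric_embedding_def)
  define w where "w x i = sqrt 2 * (\<phi> x i - \<phi> z i)" for x i
  have sq: "?D x y * ?D x y = (\<Sum>i<d. (\<phi> x i - \<phi> y i)\<^sup>2)" if "x \<in> ?T" "y \<in> ?T" for x y
    using that by (simp add: distance_matrix_def \<phi> euclidean_dist_def L2_set_def sum_nonneg)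
  have "gram ?D z x y = (\<Sum>i<d. w x i * w y i)" if "x \<in> ?T" "y \<in> ?T" for x y
    unfolding gram_def sq[OF z that(1)] sq[OF z that(2)] sq[OF that] w_def
    by (simp add: power2_eq_square flip: sum.distrib sum_subtractf)
      (simp add: algebra_simps)
  from eliminations_vanish[where g = "gram ?D z" and n = n, OF _ T this] obtain h where
    "h \<in> eliminations n d (gram ?D z)" "\<forall>x\<in>?T. \<forall>y\<in>?T. h x y = 0" by blast
  moreover from this K have "covers n h K" unfolding covers_def by blast
  ultimately show ?thesis using z by blast
qed

section \<open>The program\<close>

text \<open>Integer variable 0 holds \<open>n\<close>, variables 1 and 2 run through the points, 3 is the size of the
  best outlier set so far (stored in array 0), 4 that of the current one (array 1), 5 is the base
  point and \<open>6 + k\<close> the \<open>k\<close>-th pivot. The \<open>k\<close>-th pivot row is in real array \<open>k\<close>, the inverse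
  pivot in real variable \<open>k\<close>.\<close>

fun gexp :: "nat \<Rightarrow> iexp \<Rightarrow> iexp \<Rightarrow> rexp" where
  "gexp 0 i j = RSub (RAdd (RMul (RDist (IVar 5) i) (RDist (IVar 5) i))
      (RMul (RDist (IVar 5) j) (RDist (IVar 5) j))) (RMul (RDist i j) (RDist i j))"
| "gexp (Suc k) i j = RSub (gexp k i j) (RMul (RMul (RVar k) (RArr k i)) (RArr k j))"

fun gval :: "(nat \<Rightarrow> nat \<Rightarrow> real) \<Rightarrow> nat \<Rightarrow> state \<Rightarrow> nat \<Rightarrow> nat \<Rightarrow> real" where
  "gval D 0 s x y = gram D (ivar s 5) x y"
| "gval D (Suc k) s x y = gval D k s x y - rvar s k * rarr s k x * rarr s k y"

lemma rval_gexp [simp]: "rval D s (gexp k i j) = gval D k s (ival s i) (ival s j)"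
  by (induction k) (simp_all add: gram_def)

text \<open>The eliminated matrix is never stored: each entry is recomputed from distances and the
  \<open>k\<close> stored columns, in time linear in \<open>k\<close>.\<close>

lemma rcost_gexp [simp]: "rcost (gexp k (IVar v) (IVar w)) = 23 + 8 * k"
  by (induction k) simp_all

text \<open>A sum of marks below 1 means that both points are unmarked. The only real comparison is
  \<open><\<close>, so being nonzero is tested as having a positive square.\<close>

definition greedy_step :: "nat \<Rightarrow> com" where
  "greedy_step k =
     Branch (BAnd (ILess (IAdd (IArr 1 (IVar 1)) (IArr 1 (IVar 2))) (IConst 1))
         (RLess (RConst 0) (RMul (gexp k (IVar 1) (IVar 2)) (gexp k (IVar 1) (IVar 2)))))
       (Seq (IStore 1 (IVar 1) (IConst 1)) (IStore 1 (IVar 2) (IConst 1))) Skip"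

definition greedy :: "nat \<Rightarrow> com" where
  "greedy k = Seq (for_loop 1 (IStore 1 (IVar 1) (IConst 0))) (for_loop 1 (for_loop 2 (greedy_step k)))"

definition keep_best :: com where
  "keep_best = Seq (IAssign 4 (IConst 0))
     (Seq (for_loop 1 (IAssign 4 (IAdd (IVar 4) (IArr 1 (IVar 1)))))
       (Branch (ILess (IVar 4) (IVar 3))
         (Seq (IAssign 3 (IVar 4)) (for_loop 1 (IStore 0 (IVar 1) (IArr 1 (IVar 1))))) Skip))"

text \<open>\<open>gexp k\<close> reads only pivot data of index below \<open>k\<close>, so filling
  real variable \<open>k\<close> and real array \<open>k\<close> does not change its value.\<close>

definition eliminate :: "nat \<Rightarrow> com" where
  "eliminate k = Seq (RAssign k (gexp k (IVar (6 + k)) (IVar (6 + k))))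
     (Seq (Branch (RLess (RConst 0) (RVar k)) (RAssign k (RDiv (RConst 1) (RVar k))) (RAssign k (RConst 0)))
       (for_loop 1 (RStore k (IVar 1) (gexp k (IVar 1) (IVar (6 + k))))))"

text \<open>The recursion builds program text, \<open>m\<close> nested loops over pivots; hence
  there is one program for each dimension.\<close>

primrec search :: "nat \<Rightarrow> nat \<Rightarrow> com" where
  "search k 0 = Seq (greedy k) keep_best"
| "search k (Suc m) = for_loop (6 + k) (Seq (eliminate k) (search (Suc k) m))"

definition outlier_program :: "nat \<Rightarrow> com" where
  "outlier_program d = Seq (IAssign 3 (IVar 0))
     (Seq (for_loop 1 (IStore 0 (IVar 1) (IConst 1))) (for_loop 5 (search 0 d)))"

section \<open>Running time\<close>

text \<open>\<open>k + m + 1\<close> bounds the cost of one entry up to a constant and is the same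
  at all levels of the recursion; the factor \<open>m + 1\<close>, growing by one per level, leaves
  room for the elimination done there.\<close>

lemma time_search:
  assumes "n \<ge> 1"
  shows "time_bound n (search k m) \<le> 200 * (k + m + 1) * (m + 1) * n ^ (m + 2)"
proof (induction m arbitrary: k)
  case 0
  have "n \<le> n * n" "1 \<le> n * n" using assms by simp_all
  then have "33 + n * 50 \<le> n * (n * 127)" by linarith
  then have "33 + n * 50 \<le> n * (n * 127) + k * (n * (n * 184))" by linarith
  then show ?case
    by (simp add: greedy_def keep_best_def greedy_step_def power2_eq_square algebra_simps)
next
  case (Suc m)
  let ?N = "n ^ (m + 2)"
  have N: "n \<le> ?N" "1 \<le> ?N" using assms by simp_all
  \<comment> \<open>The summand 14 is the loop overhead: 8 per iteration, and the 6 paid once,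
    charged to every iteration.\<close>
  have "time_bound n (Seq (eliminate k) (search (Suc k) m)) + 14
      \<le> 72 * 1 + 8 * k * 1 + n * (40 + 8 * k) + 200 * (k + m + 2) * (m + 1) * ?N"
    using Suc.IH[of "Suc k"] by (simp add: eliminate_def algebra_simps)
  also have "\<dots> \<le> 72 * ?N + 8 * k * ?N + ?N * (40 + 8 * k) + 200 * (k + m + 2) * (m + 1) * ?N"
    using N by (intro add_mono mult_mono) auto
  also have "\<dots> \<le> 200 * (k + m + 2) * (m + 2) * ?N"
    by (simp add: algebra_simps)
  finally have "n * (time_bound n (Seq (eliminate k) (search (Suc k) m)) + 14)
      \<le> n * (200 * (k + m + 2) * (m + 2) * ?N)"
    by (rule mult_le_mono2)
  moreover have "n * 14 \<ge> n * 8 + 6" using assms by simp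
  ultimately show ?case
    by (simp add: algebra_simps)
qed

text \<open>The exponent counts the loop over base points, the \<open>d\<close> pivot loops and the
  two nested loops of \<open>greedy\<close>.\<close>

lemma time_outlier_program:
  assumes "n \<ge> 1"
  shows "time_bound n (outlier_program d) \<le> 200 * (d + 1) * (d + 2) * n ^ (d + 3)"
proof -
  let ?N = "n ^ (d + 2)"
  have N: "n ^ (d + 3) = n * ?N" "1 \<le> ?N" by (use assms in \<open>simp_all add: eval_nat_numeral\<close>)
  have "time_bound n (outlier_program d) \<le> n * (50 + time_bound n (search 0 d))"
    using assms by (simp add: outlier_program_def algebra_simps)
  also have "\<dots> \<le> n * (200 * (d + 1) * ?N + 200 * (d + 1) * (d + 1) * ?N)"
  proof (intro mult_le_mono2 add_mono)
    have "50 * 1 \<le> 200 * (d + 1) * ?N" using N(2) by (intro mult_mono) auto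
    then show "50 \<le> 200 * (d + 1) * ?N" by simp
    show "time_bound n (search 0 d) \<le> 200 * (d + 1) * (d + 1) * ?N"
      using time_search[OF assms, of 0 d] by simp
  qed
  finally show ?thesis unfolding N(1) by (simp add: algebra_simps)
qed

section \<open>Correctness\<close>

text \<open>What code inside the first \<open>k\<close> pivot loops must preserve: \<open>n\<close>,
  the base point, the counters of the enclosing loops, and the pivot data read by
  \<open>gval D k\<close>.\<close>

definition same_pivots :: "nat \<Rightarrow> state \<Rightarrow> state \<Rightarrow> bool" where
  "same_pivots k s s' \<longleftrightarrow> ivar s' 0 = ivar s 0 \<and> (\<forall>j<6 + k. 5 \<le> j \<longrightarrow> ivar s' j = ivar s j) \<and>
     (\<forall>j<k. rvar s' j = rvar s j \<and> rarr s' j = rarr s j)"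

lemma same_pivots_refl: "same_pivots k s s"
  by (simp add: same_pivots_def)

lemma same_pivots_trans: "same_pivots k s s' \<Longrightarrow> same_pivots k s' s'' \<Longrightarrow> same_pivots k s s''"
  by (simp add: same_pivots_def)

lemma same_pivots_mono: "same_pivots k s s' \<Longrightarrow> j \<le> k \<Longrightarrow> same_pivots j s s'"
  by (simp add: same_pivots_def)

lemma gval_cong: "same_pivots k s s' \<Longrightarrow> gval D k s' x y = gval D k s x y"
  by (induction k) (simp_all add: same_pivots_def)

definition represents :: "(nat \<Rightarrow> nat \<Rightarrow> real) \<Rightarrow> nat \<Rightarrow> nat \<Rightarrow> state \<Rightarrow> (nat \<Rightarrow> nat \<Rightarrow> real) \<Rightarrow> bool" where
  "represents D n k s g \<longleftrightarrow> ivar s 0 = n \<and> (\<forall>x<n. \<forall>y<n. gval D k s x y = g x y)"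

lemma represents_cong: "represents D n k s g \<Longrightarrow> same_pivots k s s' \<Longrightarrow> represents D n k s' g"
  by (simp add: represents_def gval_cong) (simp add: same_pivots_def)

section \<open>Greedy vertex cover\<close>

definition marked :: "nat \<Rightarrow> state \<Rightarrow> nat set" where
  "marked n s = {i. i < n \<and> iarr s 1 i \<noteq> 0}"

text \<open>Each pair marked together contains a point of every cover, and the pairs are disjoint.\<close>

definition half_covered :: "nat \<Rightarrow> (nat \<Rightarrow> nat \<Rightarrow> real) \<Rightarrow> nat set \<Rightarrow> bool" where
  "half_covered n g M \<longleftrightarrow> M \<subseteq> {..<n} \<and> (\<forall>K. covers n g K \<longrightarrow> card M \<le> 2 * card (M \<inter> K))"

text \<open>Every cover contains \<open>x\<close> or \<open>y\<close>, and both are new, so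
  \<open>M \<inter> K\<close> gains at least one point while \<open>M\<close> gains at most two. The
  case \<open>x = y\<close> is a loop of the graph.\<close>

lemma half_covered_insert_pair:
  assumes "half_covered n g M" "x < n" "y < n" "x \<notin> M" "y \<notin> M" "g x y \<noteq> 0"
  shows "half_covered n g (insert x (insert y M))"
  unfolding half_covered_def
proof (intro conjI allI impI)
  let ?M = "insert x (insert y M)"
  show "?M \<subseteq> {..<n}" using assms by (auto simp: half_covered_def)
  fix K assume K: "covers n g K"
  have fin: "finite M" using assms(1) by (auto simp: half_covered_def intro: finite_subset)
  obtain z where z: "z \<in> {x, y}" "z \<in> K" using assms K unfolding covers_def by blast
  have "insert z (M \<inter> K) \<subseteq> ?M \<inter> K" using z by auto
  then have "card (insert z (M \<inter> K)) \<le> card (?M \<inter> K)" using fin by (intro card_mono) auto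
  moreover have "card (insert z (M \<inter> K)) = Suc (card (M \<inter> K))" using fin z assms by auto
  moreover have "card ?M \<le> card M + 2" using fin by (simp add: card_insert_if)
  moreover have "card M \<le> 2 * card (M \<inter> K)" using assms(1) K by (simp add: half_covered_def)
  ultimately show "card ?M \<le> 2 * card (?M \<inter> K)" by linarith
qed

text \<open>\<open>(i, j)\<close> is the position of a lexicographic scan. By the last conjunct the
  marked set covers the pairs scanned so far, which persists because the scan never removes marks.
  Marks of at most 1 let their sum count the marked points.\<close>

definition greedy_inv ::
  "(nat \<Rightarrow> nat \<Rightarrow> real) \<Rightarrow> nat \<Rightarrow> (nat \<Rightarrow> nat \<Rightarrow> real) \<Rightarrow> state \<Rightarrow> nat \<Rightarrow> nat \<Rightarrow> state \<Rightarrow> bool" where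
  "greedy_inv D n g s0 i j s \<longleftrightarrow> rvar s = rvar s0 \<and> rarr s = rarr s0 \<and> iarr s 0 = iarr s0 0 \<and>
     (\<forall>v. v \<noteq> 1 \<longrightarrow> v \<noteq> 2 \<longrightarrow> ivar s v = ivar s0 v) \<and>
     (\<forall>x<n. iarr s 1 x \<le> 1) \<and> half_covered n g (marked n s) \<and>
     (\<forall>x<n. \<forall>y<n. x < i \<or> x = i \<and> y < j \<longrightarrow> x \<notin> marked n s \<longrightarrow> y \<notin> marked n s \<longrightarrow> g x y = 0)"

lemma greedy_inv_update_loop_var:
  "v = 1 \<or> v = 2 \<Longrightarrow>
    greedy_inv D n g s0 i j (s\<lparr>ivar := (ivar s)(v := a)\<rparr>) \<longleftrightarrow> greedy_inv D n g s0 i j s"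
  by (auto simp: greedy_inv_def marked_def)

lemma greedy_inv_next_row:
  "greedy_inv D n g s0 i n s \<Longrightarrow> greedy_inv D n g s0 (Suc i) 0 s"
  unfolding greedy_inv_def by (simp add: less_Suc_eq)

lemma runs_greedy_step:
  assumes rep: "represents D n k s0 g" and i: "i < n" and j: "j < n"
    and inv: "greedy_inv D n g s0 i j s" and v: "ivar s 1 = i" "ivar s 2 = j"
  shows "runs D n (greedy_step k) s (\<lambda>s'. ivar s' = ivar s \<and> greedy_inv D n g s0 i (Suc j) s')"
proof -
  have "same_pivots k s0 s" using inv by (simp add: greedy_inv_def same_pivots_def)
  then have g: "gval D k s i j = g i j"
    using rep i j by (simp add: gval_cong represents_def)
  let ?b = "BAnd (ILess (IAdd (IArr 1 (IVar 1)) (IArr 1 (IVar 2))) (IConst 1))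
         (RLess (RConst 0) (RMul (gexp k (IVar 1) (IVar 2)) (gexp k (IVar 1) (IVar 2))))"
  have b: "bval D s ?b \<longleftrightarrow> i \<notin> marked n s \<and> j \<notin> marked n s \<and> g i j \<noteq> 0"
    using i j v g by (auto simp: marked_def zero_less_mult_iff)
  show ?thesis
    unfolding greedy_step_def
  proof (rule runs_Branch)
    assume t: "bval D s ?b"
    let ?s = "s\<lparr>iarr := (iarr s)(1 := (iarr s 1)(i := 1, j := 1))\<rparr>"
    have m: "marked n ?s = insert i (insert j (marked n s))"
      using i j by (auto simp: marked_def)
    have "half_covered n g (marked n ?s)"
      unfolding m using inv t b i j by (intro half_covered_insert_pair) (auto simp: greedy_inv_def)
    moreover have "\<forall>x<n. \<forall>y<n. x < i \<or> x = i \<and> y < Suc j \<longrightarrow>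
        x \<notin> marked n ?s \<longrightarrow> y \<notin> marked n ?s \<longrightarrow> g x y = 0"
      using inv unfolding m greedy_inv_def by (auto simp: less_Suc_eq)
    ultimately have "greedy_inv D n g s0 i (Suc j) ?s"
      using inv unfolding greedy_inv_def by simp
    then show "runs D n (Seq (IStore 1 (IVar 1) (IConst 1)) (IStore 1 (IVar 2) (IConst 1))) s
        (\<lambda>s'. ivar s' = ivar s \<and> greedy_inv D n g s0 i (Suc j) s')"
      using v by (intro runs_Seq runs_IStore) (simp add: fun_upd_twist)
  next
    assume f: "\<not> bval D s ?b"
    have "greedy_inv D n g s0 i (Suc j) s"
      using inv f unfolding b greedy_inv_def by (auto simp: less_Suc_eq)
    then show "runs D n Skip s (\<lambda>s'. ivar s' = ivar s \<and> greedy_inv D n g s0 i (Suc j) s')"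
      by (intro runs_Skip) simp
  qed
qed

lemma runs_greedy:
  assumes rep: "represents D n k s g"
  shows "runs D n (greedy k) s (greedy_inv D n g s n 0)"
  unfolding greedy_def
proof (rule runs_Seq, rule runs_for_loop[where I = "\<lambda>i s'. rvar s' = rvar s \<and> rarr s' = rarr s \<and>
     iarr s' 0 = iarr s 0 \<and> (\<forall>v. v \<noteq> 1 \<longrightarrow> v \<noteq> 2 \<longrightarrow> ivar s' v = ivar s v) \<and> (\<forall>x<i. iarr s' 1 x = 0)"])
  show "ivar s 0 = n" using rep by (simp add: represents_def)
next
  fix s1 :: state assume n: "ivar s1 0 = n" and s1: "rvar s1 = rvar s \<and> rarr s1 = rarr s \<and>
     iarr s1 0 = iarr s 0 \<and> (\<forall>v. v \<noteq> 1 \<longrightarrow> v \<noteq> 2 \<longrightarrow> ivar s1 v = ivar s v) \<and> (\<forall>x<n. iarr s1 1 x = 0)"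
  have "marked n s1 = {}" using s1 by (auto simp: marked_def)
  then have inv: "greedy_inv D n g s 0 0 s1"
    using s1 by (simp add: greedy_inv_def half_covered_def)
  show "runs D n (for_loop 1 (for_loop 2 (greedy_step k))) s1 (greedy_inv D n g s n 0)"
  proof (rule runs_for_loop[where I = "\<lambda>i. greedy_inv D n g s i 0"])
    fix i s2 assume s2: "i < n" "ivar s2 0 = n" "ivar s2 1 = i" "greedy_inv D n g s i 0 s2"
    show "runs D n (for_loop 2 (greedy_step k)) s2 (\<lambda>s'. ivar s' 0 = n \<and> ivar s' 1 = i \<and>
        greedy_inv D n g s (Suc i) 0 (s'\<lparr>ivar := (ivar s')(1 := Suc i)\<rparr>))"
    proof (rule runs_for_loop[where I = "\<lambda>j s'. ivar s' 1 = i \<and> greedy_inv D n g s i j s'"])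
      fix j s3 assume s3: "j < n" "ivar s3 0 = n" "ivar s3 2 = j"
        "ivar s3 1 = i \<and> greedy_inv D n g s i j s3"
      from s3 runs_greedy_step[OF rep s2(1)]
      have "runs D n (greedy_step k) s3 (\<lambda>s'. ivar s' = ivar s3 \<and> greedy_inv D n g s i (Suc j) s')"
        by blast
      then show "runs D n (greedy_step k) s3 (\<lambda>s'. ivar s' 0 = n \<and> ivar s' 2 = j \<and>
         ivar (s'\<lparr>ivar := (ivar s')(2 := Suc j)\<rparr>) 1 = i \<and>
         greedy_inv D n g s i (Suc j) (s'\<lparr>ivar := (ivar s')(2 := Suc j)\<rparr>))"
        unfolding greedy_inv_update_loop_var[OF disjI2[OF refl]]
        by (rule runs_mono) (use s3 in auto)
    qed (use s2 in \<open>auto simp: greedy_inv_update_loop_var greedy_inv_next_row\<close>)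
  qed (use n inv in \<open>auto simp: greedy_inv_update_loop_var\<close>)
qed (auto intro!: runs_IStore simp: less_Suc_eq)

section \<open>Minimizing over all choices of pivots and base point\<close>

text \<open>\<open>P\<close> stays abstract because the loops only pass it along; it is instantiated
  with embeddability of the remaining points.\<close>

definition best_inv :: "nat \<Rightarrow> (nat set \<Rightarrow> bool) \<Rightarrow> state \<Rightarrow> bool" where
  "best_inv n P s \<longleftrightarrow> ivar s 3 = card (output_set n s) \<and> P (output_set n s)"

lemma best_inv_cong:
  "best_inv n P s \<Longrightarrow> ivar s' 3 = ivar s 3 \<Longrightarrow> iarr s' 0 = iarr s 0 \<Longrightarrow> best_inv n P s'"
  by (simp add: best_inv_def output_set_def)

lemma card_marked:
  assumes "\<forall>x<n. iarr s 1 x \<le> 1"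
  shows "(\<Sum>x<n. iarr s 1 x) = card (marked n s)"
proof -
  have "(\<Sum>x<n. iarr s 1 x) = (\<Sum>x<n. if x \<in> marked n s then 1 else 0)"
    using assms by (intro sum.cong) (auto simp: marked_def le_Suc_eq)
  also have "\<dots> = card ({..<n} \<inter> marked n s)"
    by (simp add: sum.If_cases)
  also have "{..<n} \<inter> marked n s = marked n s" by (auto simp: marked_def)
  finally show ?thesis .
qed

lemma runs_keep_best:
  assumes n: "ivar s 0 = n" and le1: "\<forall>x<n. iarr s 1 x \<le> 1"
    and best: "best_inv n P s" and P: "P (marked n s)"
  shows "runs D n keep_best s (\<lambda>s'. same_pivots k s s' \<and> best_inv n P s' \<and>
    ivar s' 3 = min (ivar s 3) (card (marked n s)))"
  unfolding keep_best_def
proof (rule runs_Seq, rule runs_IAssign, rule runs_Seq,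
    rule runs_for_loop[where I = "\<lambda>i s'. rvar s' = rvar s \<and> rarr s' = rarr s \<and> iarr s' = iarr s \<and>
      (\<forall>v. v \<noteq> 1 \<longrightarrow> v \<noteq> 4 \<longrightarrow> ivar s' v = ivar s v) \<and> ivar s' 4 = (\<Sum>x<i. iarr s 1 x)"])
  fix s1 :: state
  assume n1: "ivar s1 0 = n" and s1: "rvar s1 = rvar s \<and> rarr s1 = rarr s \<and> iarr s1 = iarr s \<and>
      (\<forall>v. v \<noteq> 1 \<longrightarrow> v \<noteq> 4 \<longrightarrow> ivar s1 v = ivar s v) \<and> ivar s1 4 = (\<Sum>x<n. iarr s 1 x)"
  have c: "ivar s1 4 = card (marked n s)" using s1 card_marked[OF le1] by simp
  show "runs D n (Branch (ILess (IVar 4) (IVar 3))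
         (Seq (IAssign 3 (IVar 4)) (for_loop 1 (IStore 0 (IVar 1) (IArr 1 (IVar 1))))) Skip) s1
     (\<lambda>s'. same_pivots k s s' \<and> best_inv n P s' \<and> ivar s' 3 = min (ivar s 3) (card (marked n s)))"
  proof (rule runs_Branch)
    assume less: "bval D s1 (ILess (IVar 4) (IVar 3))"
    let ?Q = "\<lambda>i s'. rvar s' = rvar s \<and> rarr s' = rarr s \<and> iarr s' 1 = iarr s 1 \<and>
      (\<forall>v. v \<noteq> 1 \<longrightarrow> v \<noteq> 3 \<longrightarrow> v \<noteq> 4 \<longrightarrow> ivar s' v = ivar s v) \<and> ivar s' 3 = card (marked n s) \<and>
      (\<forall>x<i. iarr s' 0 x = iarr s 1 x)"
    have final: "same_pivots k s s' \<and> best_inv n P s' \<and> ivar s' 3 = min (ivar s 3) (card (marked n s))"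
      if "?Q n s'" for s' :: state
    proof -
      have "output_set n s' = marked n s" using that by (auto simp: output_set_def marked_def)
      with that less c s1 P show ?thesis by (auto simp: best_inv_def same_pivots_def)
    qed
    show "runs D n (Seq (IAssign 3 (IVar 4)) (for_loop 1 (IStore 0 (IVar 1) (IArr 1 (IVar 1))))) s1
      (\<lambda>s'. same_pivots k s s' \<and> best_inv n P s' \<and> ivar s' 3 = min (ivar s 3) (card (marked n s)))"
      by (rule runs_Seq, rule runs_IAssign, rule runs_for_loop[where I = ?Q])
        (use n1 s1 c final in \<open>auto intro!: runs_IStore simp: less_Suc_eq\<close>)
  next
    assume "\<not> bval D s1 (ILess (IVar 4) (IVar 3))"
    then show "runs D n Skip s1 (\<lambda>s'. same_pivots k s s' \<and> best_inv n P s' \<and>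
        ivar s' 3 = min (ivar s 3) (card (marked n s)))"
      using s1 c best_inv_cong[OF best, of s1] by (intro runs_Skip) (simp add: same_pivots_def)
  qed
qed (use n in \<open>auto intro!: runs_IAssign\<close>)

lemma runs_eliminate:
  assumes rep: "represents D n k s g" and b: "ivar s (6 + k) = b" "b < n"
  shows "runs D n (eliminate k) s (\<lambda>s'. same_pivots k s s' \<and> represents D n (Suc k) s' (schur g b) \<and>
    (\<forall>v. v \<noteq> 1 \<longrightarrow> ivar s' v = ivar s v) \<and> iarr s' = iarr s)"
proof -
  have n: "ivar s 0 = n" using rep by (simp add: represents_def)
  have g: "gval D k s b b = g b b" using rep b by (simp add: represents_def)
  let ?r = "(rvar s)(k := pivot_inverse (g b b))"
  let ?I = "\<lambda>i s'. (\<forall>v. v \<noteq> 1 \<longrightarrow> ivar s' v = ivar s v) \<and> iarr s' = iarr s \<and> rvar s' = ?r \<and>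
    (\<forall>j<k. rarr s' j = rarr s j) \<and> (\<forall>x<i. rarr s' k x = g x b)"
  have pivots: "same_pivots k s s'" if "?I i s'" for i and s' :: state
    using that by (simp add: same_pivots_def)
  let ?store = "for_loop 1 (RStore k (IVar 1) (gexp k (IVar 1) (IVar (6 + k))))"
  let ?Q = "\<lambda>s'. same_pivots k s s' \<and> represents D n (Suc k) s' (schur g b) \<and>
    (\<forall>v. v \<noteq> 1 \<longrightarrow> ivar s' v = ivar s v) \<and> iarr s' = iarr s"
  have store: "runs D n ?store (s\<lparr>rvar := ?r\<rparr>) ?Q"
  proof (rule runs_for_loop[where I = ?I])
    fix i and s1 :: state assume i: "i < n" "ivar s1 0 = n" "ivar s1 1 = i" "?I i s1"
    have "gval D k s1 i b = g i b"
      using gval_cong[OF pivots[OF i(4)]] rep i(1) b(2) by (simp add: represents_def)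
    then show "runs D n (RStore k (IVar 1) (gexp k (IVar 1) (IVar (6 + k)))) s1
      (\<lambda>s'. ivar s' 0 = n \<and> ivar s' 1 = i \<and> ?I (Suc i) (s'\<lparr>ivar := (ivar s')(1 := Suc i)\<rparr>))"
      using i b by (intro runs_RStore) (simp add: less_Suc_eq)
  next
    fix s1 :: state assume s1: "ivar s1 0 = n" "?I n s1"
    have "represents D n (Suc k) s1 (schur g b)"
      using gval_cong[OF pivots[OF s1(2)]] rep s1 by (simp add: represents_def schur_def)
    with s1 pivots[OF s1(2)] show "?Q s1" by blast
  qed (use n in auto)
  show ?thesis
    unfolding eliminate_def
  proof (rule runs_Seq, rule runs_RAssign, rule runs_Seq, rule runs_Branch; rule runs_RAssign)
    let ?s = "s\<lparr>rvar := (rvar s)(k := rval D s (gexp k (IVar (6 + k)) (IVar (6 + k))))\<rparr>"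
    have v: "rvar ?s k = g b b" using g b by simp
    {
      assume "bval D ?s (RLess (RConst 0) (RVar k))"
      then have "?s\<lparr>rvar := (rvar ?s)(k := rval D ?s (RDiv (RConst 1) (RVar k)))\<rparr> = s\<lparr>rvar := ?r\<rparr>"
        using v by (simp add: pivot_inverse_def)
      with store show "runs D n ?store
          (?s\<lparr>rvar := (rvar ?s)(k := rval D ?s (RDiv (RConst 1) (RVar k)))\<rparr>) ?Q" by simp
    next
      assume "\<not> bval D ?s (RLess (RConst 0) (RVar k))"
      then have "?s\<lparr>rvar := (rvar ?s)(k := rval D ?s (RConst 0))\<rparr> = s\<lparr>rvar := ?r\<rparr>"
        using v by (simp add: pivot_inverse_def)
      with store show "runs D n ?store (?s\<lparr>rvar := (rvar ?s)(k := rval D ?s (RConst 0))\<rparr>) ?Q" by simp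
    }
  qed
qed

text \<open>The size recorded in variable 3 never grows, so a bound reached for one pivot sequence
  survives the rest of the search. At the innermost level, the greedy cover has at most twice the
  size of any cover of the current matrix.\<close>

lemma runs_search:
  assumes "represents D n k s g" "best_inv n P s"
    and "\<And>h K. h \<in> eliminations n m g \<Longrightarrow> covers n h K \<Longrightarrow> P K"
  shows "runs D n (search k m) s (\<lambda>s'. same_pivots k s s' \<and> best_inv n P s' \<and> ivar s' 3 \<le> ivar s 3 \<and>
    (\<forall>h \<in> eliminations n m g. \<forall>K. covers n h K \<longrightarrow> ivar s' 3 \<le> 2 * card K))"
  using assms
proof (induction m arbitrary: k g s)
  case 0
  let ?Q = "\<lambda>s'. same_pivots k s s' \<and> best_inv n P s' \<and> ivar s' 3 \<le> ivar s 3 \<and>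
    (\<forall>h \<in> eliminations n 0 g. \<forall>K. covers n h K \<longrightarrow> ivar s' 3 \<le> 2 * card K)"
  have "runs D n keep_best s1 ?Q" if inv: "greedy_inv D n g s n 0 s1" for s1
  proof -
    have n: "ivar s1 0 = n" and s1: "same_pivots k s s1" "ivar s1 3 = ivar s 3" "iarr s1 0 = iarr s 0"
      using inv "0.prems"(1) by (auto simp: greedy_inv_def represents_def same_pivots_def)
    have "covers n g (marked n s1)"
      using inv by (auto simp: covers_def greedy_inv_def half_covered_def)
    then have P: "P (marked n s1)" using "0.prems"(3) by simp
    have card: "card (marked n s1) \<le> 2 * card K" if "covers n g K" for K
    proof -
      have "card (marked n s1) \<le> 2 * card (marked n s1 \<inter> K)"
        using inv that by (simp add: greedy_inv_def half_covered_def)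
      also have "card (marked n s1 \<inter> K) \<le> card K"
        using that by (intro card_mono) (auto simp: covers_def intro: finite_subset)
      finally show ?thesis by simp
    qed
    have "\<forall>x<n. iarr s1 1 x \<le> 1" using inv by (simp add: greedy_inv_def)
    from runs_keep_best[OF n this best_inv_cong[OF "0.prems"(2) s1(2,3)] P, where D = D and k = k]
    show ?thesis
      by (rule runs_mono) (use s1 card same_pivots_trans in \<open>force simp: min_le_iff_disj\<close>)
  qed
  with runs_greedy[OF "0.prems"(1)] show ?case
    by (auto intro: runs_Seq runs_mono)
next
  case (Suc m)
  let ?I = "\<lambda>i s'. same_pivots k s s' \<and> best_inv n P s' \<and> ivar s' 3 \<le> ivar s 3 \<and>
    (\<forall>b<i. \<forall>h \<in> eliminations n m (schur g b). \<forall>K. covers n h K \<longrightarrow> ivar s' 3 \<le> 2 * card K)"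
  \<comment> \<open>The loop counter \<open>6 + k\<close> lies just beyond the range protected by
    \<open>same_pivots k\<close>, so advancing it preserves the invariant.\<close>
  have upd: "?I i (s'\<lparr>ivar := (ivar s')(6 + k := a)\<rparr>) \<longleftrightarrow> ?I i s'" for i s' a
    by (auto simp: same_pivots_def best_inv_def output_set_def)
  show ?case
    unfolding search.simps
  proof (rule runs_for_loop[where I = ?I])
    show "ivar s 0 = n" using Suc.prems(1) by (simp add: represents_def)
    show "?I 0 (s\<lparr>ivar := (ivar s)(6 + k := 0)\<rparr>)"
      unfolding upd using Suc.prems(2) by (simp add: same_pivots_refl)
  next
    fix i and s1 :: state
    assume i: "i < n" "ivar s1 0 = n" "ivar s1 (6 + k) = i" and I: "?I i s1"
    have rep: "represents D n k s1 g" using I Suc.prems(1) represents_cong by blast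
    let ?R = "\<lambda>s'. ivar s' 0 = n \<and> ivar s' (6 + k) = i \<and> ?I (Suc i) (s'\<lparr>ivar := (ivar s')(6 + k := Suc i)\<rparr>)"
    have "runs D n (search (Suc k) m) s2 ?R"
      if s2: "same_pivots k s1 s2" "represents D n (Suc k) s2 (schur g i)"
        "\<forall>v. v \<noteq> 1 \<longrightarrow> ivar s2 v = ivar s1 v" "iarr s2 = iarr s1" for s2
    proof -
      have "best_inv n P s2" using best_inv_cong[of n P s1 s2] I s2 by simp
      moreover have "P K" if "h \<in> eliminations n m (schur g i)" "covers n h K" for h K
        using Suc.prems(3)[of h K] that i(1) by auto
      ultimately have "runs D n (search (Suc k) m) s2 (\<lambda>s'. same_pivots (Suc k) s2 s' \<and>
          best_inv n P s' \<and> ivar s' 3 \<le> ivar s2 3 \<and>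
          (\<forall>h \<in> eliminations n m (schur g i). \<forall>K. covers n h K \<longrightarrow> ivar s' 3 \<le> 2 * card K))"
        by (rule Suc.IH[OF s2(2)])
      then show ?thesis
      proof (rule runs_mono)
        fix s' assume s': "same_pivots (Suc k) s2 s' \<and> best_inv n P s' \<and> ivar s' 3 \<le> ivar s2 3 \<and>
          (\<forall>h \<in> eliminations n m (schur g i). \<forall>K. covers n h K \<longrightarrow> ivar s' 3 \<le> 2 * card K)"
        have "same_pivots k s s'"
          using I s' s2(1) same_pivots_mono[of "Suc k" s2 s' k]
          by (meson same_pivots_trans le_SucI order_refl)
        moreover have le: "ivar s' 3 \<le> ivar s1 3" using s' s2(3) by simp
        moreover have "\<forall>b<Suc i. \<forall>h \<in> eliminations n m (schur g b). \<forall>K. covers n h K \<longrightarrow>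
            ivar s' 3 \<le> 2 * card K"
          using I s' le by (auto simp: less_Suc_eq intro: order_trans)
        ultimately have "?I (Suc i) s'" using I s' by auto
        moreover have "ivar s' 0 = n" "ivar s' (6 + k) = i"
          using s' s2(3) i by (auto simp: same_pivots_def)
        ultimately show "?R s'" unfolding upd by blast
      qed
    qed
    with runs_eliminate[OF rep i(3) i(1)]
    show "runs D n (Seq (eliminate k) (search (Suc k) m)) s1 ?R"
      by (intro runs_Seq) (auto intro: runs_mono)
  qed (use Suc.prems in auto)
qed

text \<open>The search starts from the outlier set of all points, whence the assumption
  \<open>P {..<n}\<close>.\<close>

lemma runs_outlier_program:
  assumes P: "P {..<n}" "\<And>z h K. z < n \<Longrightarrow> h \<in> eliminations n d (gram D z) \<Longrightarrow> covers n h K \<Longrightarrow> P K"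
  shows "runs D n (outlier_program d) (initial_state n) (\<lambda>s. best_inv n P s \<and>
    (\<forall>z<n. \<forall>h \<in> eliminations n d (gram D z). \<forall>K. covers n h K \<longrightarrow> ivar s 3 \<le> 2 * card K))"
  unfolding outlier_program_def
proof (rule runs_Seq, rule runs_IAssign, rule runs_Seq,
    rule runs_for_loop[where I = "\<lambda>i s. ivar s 3 = n \<and> (\<forall>x<i. iarr s 0 x = 1)"])
  fix s :: state assume s: "ivar s 0 = n" "ivar s 3 = n \<and> (\<forall>x<n. iarr s 0 x = 1)"
  have "output_set n s = {..<n}" using s by (auto simp: output_set_def)
  then have best: "best_inv n P s" using s P(1) by (simp add: best_inv_def)
  let ?I = "\<lambda>i s. best_inv n P s \<and>
    (\<forall>z<i. \<forall>h \<in> eliminations n d (gram D z). \<forall>K. covers n h K \<longrightarrow> ivar s 3 \<le> 2 * card K)"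
  have upd: "?I i (s'\<lparr>ivar := (ivar s')(5 := a)\<rparr>) \<longleftrightarrow> ?I i s'" for i s' a
    by (auto simp: best_inv_def output_set_def)
  show "runs D n (for_loop 5 (search 0 d)) s (?I n)"
  proof (rule runs_for_loop[where I = ?I])
    fix i and s1 :: state assume i: "i < n" "ivar s1 0 = n" "ivar s1 5 = i" and I: "?I i s1"
    have "runs D n (search 0 d) s1 (\<lambda>s'. same_pivots 0 s1 s' \<and> best_inv n P s' \<and>
      ivar s' 3 \<le> ivar s1 3 \<and>
      (\<forall>h \<in> eliminations n d (gram D i). \<forall>K. covers n h K \<longrightarrow> ivar s' 3 \<le> 2 * card K))"
      using i I P(2) by (intro runs_search) (auto simp: represents_def)
    then show "runs D n (search 0 d) s1 (\<lambda>s'. ivar s' 0 = n \<and> ivar s' 5 = i \<and>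
        ?I (Suc i) (s'\<lparr>ivar := (ivar s')(5 := Suc i)\<rparr>))"
      unfolding upd
      by (rule runs_mono) (use i I in \<open>auto simp: same_pivots_def less_Suc_eq intro: order_trans\<close>)
  next
    show "?I 0 (s\<lparr>ivar := (ivar s)(5 := 0)\<rparr>)" unfolding upd using best by simp
  qed (use s in auto)
qed (auto intro!: runs_IStore simp: initial_state_def less_Suc_eq)

theorem theorem15:
  "\<exists>p :: nat poly. \<forall>d\<ge>1. \<exists>A :: com.
     \<forall>(n :: nat) (\<rho> :: nat \<Rightarrow> nat \<Rightarrow> real). Metric_space {..<n} \<rho> \<longrightarrow>
       (\<exists>t S. computes A n \<rho> t S \<and>
          (n \<ge> 1 \<longrightarrow> t \<le> poly p d * n ^ (d + 3)) \<and>
          S \<subseteq> {..<n} \<and>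
          embeddable d ({..<n} - S) \<rho> \<and>
          (\<forall>Sopt. minimum_outlier_set d {..<n} \<rho> Sopt \<longrightarrow> card S \<le> 2 * card Sopt))"
proof (intro exI[of _ "[:200:] * [:1, 1:] * [:2, 1:]"] allI impI exI[of _ "outlier_program _"])
  fix d n :: nat and \<rho> :: "nat \<Rightarrow> nat \<Rightarrow> real"
  assume M: "Metric_space {..<n} \<rho>"
  let ?D = "distance_matrix n \<rho>"
  let ?P = "\<lambda>K. embeddable d ({..<n} - K) \<rho>"
  have "?P {..<n}" by (simp add: embeddable_def isometric_embedding_def)
  with runs_outlier_program[where P = ?P and D = ?D and d = d and n = n] embeddable_if_covers[OF M]
  obtain t s where t: "exec ?D (outlier_program d) (initial_state n) t s"
    "t \<le> time_bound n (outlier_program d)"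
    and best: "best_inv n ?P s"
    and opt: "\<And>z h K. z < n \<Longrightarrow> h \<in> eliminations n d (gram ?D z) \<Longrightarrow> covers n h K \<Longrightarrow> ivar s 3 \<le> 2 * card K"
    unfolding runs_def by blast
  let ?S = "output_set n s"
  have S: "?S \<subseteq> {..<n}" by (auto simp: output_set_def)
  have card: "card ?S \<le> 2 * card K" if "minimum_outlier_set d {..<n} \<rho> K" for K
  proof (cases "K = {..<n}")
    case True
    \<comment> \<open>With no retained point there is no base point to choose; the bound holds
      because \<open>?S\<close> consists of points of the space.\<close>
    have "card ?S \<le> card K" unfolding True by (intro card_mono S) simp
    then show ?thesis by simp
  next
    case False
    have "outlier_set d {..<n} \<rho> K"
      using that by (simp add: minimum_outlier_set_def is_arg_min_def)
    from covers_if_outlier_set[OF this False] opt best show ?thesis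
      unfolding best_inv_def by metis
  qed
  have "t \<le> poly ([:200:] * [:1, 1:] * [:2, 1:]) d * n ^ (d + 3)" if "n \<ge> 1"
    using t(2) time_outlier_program[OF that, of d] by (simp add: algebra_simps)
  with t(1) S best card show "\<exists>t S. computes (outlier_program d) n \<rho> t S \<and>
      (n \<ge> 1 \<longrightarrow> t \<le> poly ([:200:] * [:1, 1:] * [:2, 1:]) d * n ^ (d + 3)) \<and> S \<subseteq> {..<n} \<and> ?P S \<and>
      (\<forall>Sopt. minimum_outlier_set d {..<n} \<rho> Sopt \<longrightarrow> card S \<le> 2 * card Sopt)"
    unfolding computes_def best_inv_def by (intro exI[of _ t] exI[of _ ?S]) blast
qed

end
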